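(* Let $r\geq 8$ be an integer. Then the power series expansion around the origin of the rational function $$\frac{1}{1-\sum_{i=1}^r t_i + r!\prod_{i=1}^r t_i}$$ in the variables $t_1,\ldots,t_r$ has only nonnegative coefficients. *)

theory Defs
  imports Complex_Main
begin

text \<open>Formal power series in the variables t_0, ..., t_(r-1) with real coefficients,
  represented by their coefficient function on multi-indices.  A multi-index is a
  function m :: nat => nat with m i = 0 for i >= r (exponent of t_i is m i).\<close>

definition mi_supp :: "nat \<Rightarrow> (nat \<Rightarrow> nat) set" where
  "mi_supp r = {m. \<forall>i\<ge>r. m i = 0}"

definition mfps_mult :: "nat \<Rightarrow> ((nat \<Rightarrow> nat) \<Rightarrow> real) \<Rightarrow> ((nat \<Rightarrow> nat) \<Rightarrow> real)
                          \<Rightarrow> (nat \<Rightarrow> nat) \<Rightarrow> real" where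
  "mfps_mult r F G m =
     (\<Sum>a\<in>{a\<in>mi_supp r. \<forall>i. a i \<le> m i}. F a * G (\<lambda>i. m i - a i))"

definition mfps_one :: "(nat \<Rightarrow> nat) \<Rightarrow> real" where
  "mfps_one m = (if m = (\<lambda>_. 0) then 1 else 0)"

definition denom :: "nat \<Rightarrow> (nat \<Rightarrow> nat) \<Rightarrow> real" where
  "denom r m =
     (if m = (\<lambda>_. 0) then 1 else 0)
     - (\<Sum>i<r. if m = (\<lambda>j. if j = i then 1 else 0) then 1 else 0)
     + fact r * (if m = (\<lambda>j. if j < r then 1 else 0) then 1 else 0)"

end

theory Submission
  imports Defs "HOL-Library.Function_Algebras"
begin

text \<open>Write \<open>e\<^sub>i\<close> for the unit vectors, \<open>1\<close> for the all-ones vector, \<open>|m|\<close> for the sum of the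
  entries of \<open>m\<close>, and let \<open>F m\<close> be the coefficients of \<open>1 / (1 - S + c P)\<close>, where \<open>c = r!\<close>, \<open>S\<close> is
  the sum and \<open>P\<close> the product of the variables. A first order differential equation for the series
  gives \<open>m\<^sub>i F(m - e\<^sub>k) - m\<^sub>k F(m - e\<^sub>i) = c (m\<^sub>i - m\<^sub>k) F(m - 1)\<close>. Hence nonnegativity propagates from
  vectors with nearly equal entries to all others, and summing over \<open>k\<close> yields
  \<open>m\<^sub>i F(m) = |m| F(m - e\<^sub>i) - c (|m| - (r - 1) m\<^sub>i) F(m - 1)\<close>. Along a chain of balanced vectors this
  is a recurrence for a single sequence \<open>b\<^sub>N\<close>. With \<open>p = \<lceil>N / r\<rceil>\<close>, it gives inductively
  \<open>b\<^sub>N \<ge> (1 - 1 / (2 r)) (N / p) b\<^sub>N\<^sub>-\<^sub>1\<close> for \<open>N \<ge> r + 2\<close>, because the product of \<open>r\<close> consecutive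
  factors \<open>N / p\<close> is at least \<open>(2 r)! / (r! 2\<^sup>r) \<ge> 4 r r!\<close>.\<close>

section \<open>Exponent vectors with integer entries, so that shifts are never truncated\<close>

definition unit_vec :: "nat \<Rightarrow> nat \<Rightarrow> int" where
  "unit_vec k = (\<lambda>j. if j = k then 1 else 0)"

definition ones :: "nat \<Rightarrow> nat \<Rightarrow> int" where
  "ones r = (\<lambda>j. if j < r then 1 else 0)"

definition weight :: "nat \<Rightarrow> (nat \<Rightarrow> int) \<Rightarrow> int" where
  "weight r m = (\<Sum>i<r. m i)"

lemma weight_diff: "weight r (m - n) = weight r m - weight r n"
  by (simp add: weight_def sum_subtractf)

lemma weight_add: "weight r (m + n) = weight r m + weight r n"
  by (simp add: weight_def sum.distrib)

lemma weight_unit_vec: "k < r \<Longrightarrow> weight r (unit_vec k) = 1"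
  by (simp add: weight_def unit_vec_def)

lemma weight_ones: "weight r (ones r) = int r"
  by (simp add: weight_def ones_def)

lemma weight_neg_imp:
  assumes "weight r m < 0"
  obtains i where "i < r" "m i < 0"
  using assms sum_nonneg[of "{..<r}" m] unfolding weight_def by (meson lessThan_iff not_le)

section \<open>Numerical estimates for products of growth factors\<close>

lemma fact_double_ge:
  assumes "8 \<le> r"
  shows "4 * real r * fact r * fact r * 2 ^ r \<le> fact (2 * r)"
  using assms
proof (induction r rule: dec_induct)
  case base
  \<comment> \<open>The inequality fails for \<open>r = 7\<close>, so the induction cannot start
    earlier.\<close>
  show ?case by (simp add: fact_numeral)
next
  case (step r)
  have r: "8 \<le> real r" using step(1) by simp
  then have "8 * real r \<le> real r * real r" by (rule mult_right_mono) simp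
  \<comment> \<open>Passing from \<open>r\<close> to \<open>r + 1\<close> multiplies the left side
    by \<open>2 (r + 1)^3 / r\<close> and the right side by \<open>(2 r + 2) (2 r + 1)\<close>;
    cancelling leaves this quadratic inequality.\<close>
  then have "(real r + 1) * (real r + 1) \<le> (2 * real r + 1) * real r"
    using r by (simp only: ring_distribs)
  then have "(8 * (real r + 1) * fact r * fact r * 2 ^ r) * ((real r + 1) * (real r + 1))
     \<le> (8 * (real r + 1) * fact r * fact r * 2 ^ r) * ((2 * real r + 1) * real r)"
    by (rule mult_left_mono) simp
  also have "\<dots> = (2 * real r + 2) * (2 * real r + 1) * (4 * real r * fact r * fact r * 2 ^ r)"
    by (simp add: algebra_simps)
  also have "\<dots> \<le> (2 * real r + 2) * (2 * real r + 1) * fact (2 * r)"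
    using step.IH by (rule mult_left_mono) simp
  also have "\<dots> = fact (2 * Suc r)" by (simp add: algebra_simps)
  also have "8 * (real r + 1) * fact r * fact r * 2 ^ r * ((real r + 1) * (real r + 1))
      = 4 * real (Suc r) * fact (Suc r) * fact (Suc r) * 2 ^ Suc r"
    by (simp add: mult_ac add.commute)
  finally show ?case .
qed

text \<open>For \<open>N > 0\<close> the denominator is the ceiling of \<open>N / r\<close>. This is
  the factor leading from \<open>b (N - 1)\<close> to \<open>b N\<close> when the correction term of
  the recurrence is ignored.\<close>

definition ratio :: "nat \<Rightarrow> nat \<Rightarrow> real" where
  "ratio r N = real N / real ((N - 1) div r + 1)"

lemma ratio_nonneg: "ratio r N \<ge> 0"
  by (simp add: ratio_def)

text \<open>With \<open>p\<close> the ceiling of \<open>N / r\<close>, the right side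
  \<open>(N + r) / (p + 1)\<close> is the mediant of \<open>N / p\<close> and \<open>r / 1\<close>,
  and \<open>N / p\<close> is at most \<open>r\<close>.\<close>

lemma ratio_shift:
  assumes "0 < r" "0 < N"
  shows "ratio r N \<le> ratio r (N + r)"
proof -
  obtain n where n: "N = Suc n" using assms by (cases N) auto
  define q where "q = n div r"
  have "n = q * r + n mod r" by (simp add: q_def)
  moreover have "n mod r < r" using assms by simp
  ultimately have "Suc n \<le> r * (q + 1)" by (simp add: algebra_simps)
  then have "real (Suc n) \<le> real (r * (q + 1))" by (simp only: of_nat_le_iff)
  then show ?thesis using assms
    by (simp add: ratio_def n q_def[symmetric] field_simps)
qed

text \<open>Moving the window of \<open>r\<close> factors by one trades
  \<open>ratio r (N + 1 - r)\<close> for \<open>ratio r (N + 1)\<close>, which is no smaller by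
  \<open>ratio_shift\<close>. So the worst window ends at \<open>2 * r\<close>, and there every
  factor is \<open>k / 2\<close>.\<close>

lemma prod_ratio_ge:
  assumes "8 \<le> r" "2 * r \<le> N"
  shows "4 * real r * fact r \<le> (\<Prod>k\<in>{Suc (N - r)..N}. ratio r k)"
  using assms(2)
proof (induction N rule: dec_induct)
  case base
  have "(\<Prod>k\<in>{Suc r..2 * r}. ratio r k) = (\<Prod>k\<in>{Suc r..2 * r}. real k / 2)"
  proof (intro prod.cong refl)
    fix k assume k: "k \<in> {Suc r..2 * r}"
    have "(k - 1) div r = 1"
      using k by (intro div_nat_eqI) auto
    then show "ratio r k = real k / 2" by (simp add: ratio_def)
  qed
  also have "\<dots> = (\<Prod>k\<in>{Suc r..2 * r}. real k) / 2 ^ r"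
    by (simp add: prod_dividef)
  also have "(\<Prod>k\<in>{Suc r..2 * r}. real k) = fact (2 * r) / fact r"
  proof -
    have "{1..2 * r} = {1..r} \<union> {Suc r..2 * r}" by auto
    then have "(\<Prod>k\<in>{1..2 * r}. real k) = (\<Prod>k\<in>{1..r}. real k) * (\<Prod>k\<in>{Suc r..2 * r}. real k)"
      by (simp only:) (rule prod.union_disjoint; auto)
    then show ?thesis by (simp add: fact_prod)
  qed
  finally have "(\<Prod>k\<in>{Suc r..2 * r}. ratio r k) = fact (2 * r) / fact r / 2 ^ r" .
  then show ?case
    using fact_double_ge[OF assms(1)] by (simp add: pos_le_divide_eq ac_simps)
next
  case (step N)
  let ?A = "{Suc (Suc N - r)..N}"
  have "{Suc (N - r)..N} = insert (Suc N - r) ?A" "{Suc (Suc N - r)..Suc N} = insert (Suc N) ?A"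
    using step assms(1) by auto
  then have *: "(\<Prod>k\<in>{Suc (N - r)..N}. ratio r k) = ratio r (Suc N - r) * (\<Prod>k\<in>?A. ratio r k)"
     "(\<Prod>k\<in>{Suc (Suc N - r)..Suc N}. ratio r k) = ratio r (Suc N) * (\<Prod>k\<in>?A. ratio r k)"
    by simp_all
  have "ratio r (Suc N - r) \<le> ratio r (Suc N)"
    using ratio_shift[of r "Suc N - r"] step assms(1) by simp
  then show ?case
    using step.IH unfolding *
    by (meson mult_right_mono order_trans prod_nonneg ratio_nonneg)
qed

section \<open>Nonnegativity of the sequence along the balanced chain\<close>

lemma balanced_sequence_nonneg:
  fixes b :: "nat \<Rightarrow> real"
  assumes r: "8 \<le> r"
    and b0: "b 0 = 1"
    and small: "\<And>N. Suc N < r \<Longrightarrow> b (Suc N) = real (Suc N) * b N"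
    and large: "\<And>N. r \<le> Suc N \<Longrightarrow> real (N div r + 1) * b (Suc N) = real (Suc N) * b N
      - fact r * (real (Suc N) - (real r - 1) * real (N div r + 1)) * b (Suc N - r)"
  shows "b N \<ge> 0"
proof -
  have first: "b s = fact s" if "s < r" for s
    using that by (induction s) (auto simp: b0 small)
  \<comment> \<open>The constant \<open>r!\<close> cancels the initial growth exactly:
    \<open>r * b (r - 1) = r!\<close> against \<open>r! * b 0\<close>.\<close>
  have b_r: "b r = 0"
  proof -
    obtain q where q: "r = Suc q" using r by (cases r) auto
    then have "q div r = 0" by simp
    then show ?thesis using large[of q] first[of q] b0 q by (simp add: algebra_simps)
  qed
  \<comment> \<open>Here the ceiling is 2. The correction helps or vanishes for
    \<open>s <= r - 3\<close>, has coefficient -1 at \<open>s = r - 2\<close>, and at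
    \<open>s = r - 1\<close> it multiplies \<open>b r = 0\<close>. Hence only the weight
    \<open>2 * r - 1\<close> needs a real estimate in this range.\<close>
  have second: "2 * b (r + Suc s) = real (r + Suc s) * b (r + s)
      + fact r * (real r - real s - 3) * b (Suc s)" if "s < r" for s
  proof -
    have "(r + s) div r = 1" using that by (intro div_nat_eqI) auto
    then show ?thesis using large[of "r + s"] by (simp add: algebra_simps)
  qed
  \<comment> \<open>The constant makes \<open>s = 0\<close> an equality. Afterwards the helpful
    correction is dropped and each step gains a factor \<open>(r + s + 2) / 2\<close>, which is at
    least \<open>s + 3\<close>. The case \<open>s = r - 3\<close> is what the weight
    \<open>2 * r - 1\<close> requires.\<close>
  have lower: "b (r + Suc s) \<ge> fact r * (real r - 3) / 4 * fact (Suc (Suc s))" if "s + 3 \<le> r" for s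
    using that
  proof (induction s)
    case 0
    then show ?case using second[of 0] first[of 1] b_r r by simp
  next
    case (Suc s)
    let ?C = "fact r * (real r - 3) / 4 :: real"
    have C: "?C \<ge> 0" using Suc by simp
    have "fact r * (real r - real (Suc s) - 3) * b (Suc (Suc s)) \<ge> 0"
      using Suc.prems first[of "Suc (Suc s)"] by simp
    then have "2 * b (r + Suc (Suc s)) \<ge> real (r + Suc (Suc s)) * b (r + Suc s)"
      using second[of "Suc s"] Suc.prems by simp
    moreover have "real (r + Suc (Suc s)) * b (r + Suc s) \<ge> (2 * real (s + 3)) * (?C * fact (Suc (Suc s)))"
      using Suc C by (intro mult_mono) auto
    ultimately have "b (r + Suc (Suc s)) \<ge> real (s + 3) * (?C * fact (Suc (Suc s)))" by linarith
    also have "real (s + 3) * (?C * fact (Suc (Suc s))) = ?C * fact (Suc (Suc (Suc s)))"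
      using fact_Suc[of "Suc (Suc s)", where 'a = real] by simp
    finally show ?case .
  qed
  \<comment> \<open>This loss factor reproduces itself: by Bernoulli, \<open>r - 1\<close> losses
    still leave a factor 1/2, and half of the product bound \<open>4 * r * r!\<close> makes the next
    correction at most the fraction \<open>1 / (2 * r)\<close> of the main term.\<close>
  define y where "y = 1 - 1 / (2 * real r)"
  have y: "0 \<le> y" "y \<le> 1" using r by (auto simp: y_def field_simps)
  have step: "b N \<ge> 0 \<and> (r + 2 \<le> N \<longrightarrow> b N \<ge> y * ratio r N * b (N - 1))" if "r < N" for N
    using that
  proof (induction N rule: less_induct)
    case (less N)
    have nn: "b M \<ge> 0" if "M < N" for M
      using that less.IH[of M] first[of M] b_r by (cases M r rule: linorder_cases) auto
    consider "N + 2 \<le> 2 * r" | "N + 1 = 2 * r" | "N = 2 * r" | "2 * r < N" by linarith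
    then show ?case
    proof cases
      case 1
      define s where "s = N - r - 1"
      have s: "N = r + Suc s" "s + 3 \<le> r" using 1 less.prems by (auto simp: s_def)
      have "(N - 1) div r = 1" using s by (intro div_nat_eqI) auto
      then have ra: "ratio r N = real N / 2" by (simp add: ratio_def)
      have "fact r * (real r - real s - 3) * b (Suc s) \<ge> 0"
        using s first[of "Suc s"] by simp
      then have "b N \<ge> real N / 2 * b (N - 1)" using second[of s] s by simp
      moreover have "y * (real N / 2 * b (N - 1)) \<le> 1 * (real N / 2 * b (N - 1))"
        using y nn[of "N - 1"] less.prems by (intro mult_right_mono) auto
      moreover have "0 \<le> real N / 2 * b (N - 1)" using nn[of "N - 1"] less.prems by simp
      ultimately show ?thesis unfolding ra by (simp add: mult.assoc)
    next
      case 2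
      define s where "s = r - 2"
      have s: "N = r + Suc s" "s + 2 = r" using 2 r by (auto simp: s_def)
      have "(N - 1) div r = 1" using s by (intro div_nat_eqI) auto
      then have ra: "ratio r N = real N / 2" by (simp add: ratio_def)
      have N: "real N = 2 * real r - 1" using 2 by simp
      have bs: "b (Suc s) = fact (Suc s)" using s by (intro first) auto
      have "real r - real s - 3 = -1" using s(2) by linarith
      then have "2 * b N = real N * b (N - 1) + fact r * -1 * fact (Suc s)"
        using second[of s] s(1) s(2)[symmetric] bs by (simp del: fact_Suc)
      \<comment> \<open>The negative correction must fit into the fraction
        \<open>1 / (2 * r)\<close> of the main term. By \<open>lower\<close> this reduces to
        \<open>(2 r - 1) (r - 3) >= 8 r\<close>, true for \<open>r >= 8\<close> and false for
        \<open>r = 7\<close>.\<close>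
      moreover have "fact r * fact (Suc s) \<le> real N / (2 * real r) * b (N - 1)"
      proof -
        have "b (N - 1) \<ge> fact r * (real r - 3) / 4 * fact (Suc s)"
          using lower[of "s - 1"] s r by simp
        then have "real N / (2 * real r) * b (N - 1) \<ge> real N / (2 * real r) * (fact r * (real r - 3) / 4 * fact (Suc s))"
          by (intro mult_left_mono) auto
        moreover have "real N / (2 * real r) * (real r - 3) / 4 \<ge> 1"
        proof -
          have "(real r - 8) * (2 * real r - 1) \<ge> 0" using r by simp
          then have "(2 * real r - 1) * (real r - 3) \<ge> 8 * real r"
            using r by (simp add: algebra_simps)
          then show ?thesis using r by (simp add: N field_simps)
        qed
        then have "real N / (2 * real r) * (real r - 3) / 4 * (fact r * fact (Suc s)) \<ge> 1 * (fact r * fact (Suc s))"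
          by (intro mult_right_mono) auto
        ultimately show ?thesis by (simp add: field_simps)
      qed
      ultimately have *: "b N \<ge> y * (real N / 2) * b (N - 1)"
        by (simp add: y_def algebra_simps)
      moreover have "0 \<le> y * (real N / 2) * b (N - 1)" using y nn[of "N - 1"] less.prems by simp
      ultimately show ?thesis unfolding ra by auto
    next
      case 3
      define s where "s = r - 1"
      have s: "N = r + Suc s" "Suc s = r" "N - 1 = r + s" using 3 r by (auto simp: s_def)
      have "(N - 1) div r = 1" using s by (intro div_nat_eqI) auto
      then have ra: "ratio r N = real N / 2" by (simp add: ratio_def)
      have "b N = real N / 2 * b (N - 1)" using second[of s] s b_r by simp
      moreover have "y * (real N / 2 * b (N - 1)) \<le> 1 * (real N / 2 * b (N - 1))"
        using y nn[of "N - 1"] less.prems by (intro mult_right_mono) auto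
      moreover have "0 \<le> real N / 2 * b (N - 1)" using nn[of "N - 1"] less.prems by simp
      ultimately show ?thesis unfolding ra by (simp add: mult.assoc)
    next
      case 4
      \<comment> \<open>Unrolls the growth bound from \<open>N - 1\<close> down to
        \<open>N - r\<close>. As \<open>N > 2 * r\<close>, every index at which the bound is invoked
        is at least \<open>r + 2\<close>.\<close>
      have chain: "b (N - 1) \<ge> y ^ j * (\<Prod>k\<in>{N - j..<N}. ratio r k) * b (N - 1 - j)" if "j < r" for j
        using that
      proof (induction j)
        case (Suc j)
        have "{N - Suc j..<N} = insert (N - Suc j) {N - j..<N}" using Suc 4 by auto
        moreover have "N - Suc j \<notin> {N - j..<N}" using Suc 4 by auto
        ultimately have pr: "(\<Prod>k\<in>{N - Suc j..<N}. ratio r k) = ratio r (N - Suc j) * (\<Prod>k\<in>{N - j..<N}. ratio r k)"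
          by simp
        have "b (N - Suc j) \<ge> y * ratio r (N - Suc j) * b (N - Suc j - 1)"
          using less.IH[of "N - Suc j"] 4 Suc by auto
        then have "y ^ j * (\<Prod>k\<in>{N - j..<N}. ratio r k) * b (N - Suc j)
          \<ge> y ^ j * (\<Prod>k\<in>{N - j..<N}. ratio r k) * (y * ratio r (N - Suc j) * b (N - Suc j - 1))"
          using y by (intro mult_left_mono mult_nonneg_nonneg prod_nonneg) (auto simp: ratio_nonneg)
        then show ?case using Suc unfolding pr by (simp add: algebra_simps)
      qed simp
      have "1 + real (r - 1) * (- (1 / (2 * real r))) \<le> (1 + - (1 / (2 * real r))) ^ (r - 1)"
        by (rule Bernoulli_inequality) (use r in \<open>auto simp: field_simps\<close>)
      moreover have "1 / 2 \<le> 1 + real (r - 1) * (- (1 / (2 * real r)))"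
        using r by (simp add: field_simps of_nat_diff)
      ultimately have half: "1 / 2 \<le> y ^ (r - 1)" by (simp add: y_def)
      have "{Suc (N - r)..N} = insert N {N - (r - 1)..<N}" using 4 r by auto
      then have pr: "(\<Prod>k\<in>{Suc (N - r)..N}. ratio r k) = ratio r N * (\<Prod>k\<in>{N - (r - 1)..<N}. ratio r k)"
        by simp
      have "1 / 2 * (4 * real r * fact r) * b (N - r)
          \<le> y ^ (r - 1) * (\<Prod>k\<in>{Suc (N - r)..N}. ratio r k) * b (N - r)"
        using half prod_ratio_ge[OF r, of N] 4 nn[of "N - r"] r y
        by (intro mult_right_mono mult_mono) auto
      also have "\<dots> = ratio r N * (y ^ (r - 1) * (\<Prod>k\<in>{N - (r - 1)..<N}. ratio r k) * b (N - r))"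
        unfolding pr by simp
      also have "\<dots> \<le> ratio r N * b (N - 1)"
        using chain[of "r - 1"] r 4 by (intro mult_left_mono ratio_nonneg) (auto simp: ac_simps)
      finally have key: "fact r * b (N - r) \<le> 1 / (2 * real r) * (ratio r N * b (N - 1))"
        using r by (simp add: field_simps)
      obtain n where n: "N = Suc n" using less.prems by (cases N) auto
      define p where "p = n div r + 1"
      \<comment> \<open>Hence \<open>N - (r - 1) * p <= p\<close>, so after division by
        \<open>p\<close> the correction costs at most \<open>r! * b (N - r)\<close>.\<close>
      have rp: "real N \<le> real r * real p"
      proof -
        have "n = r * (n div r) + n mod r" by simp
        moreover have "n mod r < r" using r by simp
        ultimately have "Suc n \<le> r * (n div r) + r" by linarith
        then have "N \<le> r * p" by (simp add: n p_def)
        then show ?thesis by (metis of_nat_le_iff of_nat_mult)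
      qed
      have p: "p > 0" and ra: "ratio r N = real N / real p" by (simp_all add: p_def ratio_def n)
      have "real p * b N = real N * b (N - 1) - fact r * (real N - (real r - 1) * real p) * b (N - r)"
        using large[of n] 4 n by (simp add: p_def)
      moreover have "fact r * (real N - (real r - 1) * real p) * b (N - r) \<le> fact r * real p * b (N - r)"
        using rp nn[of "N - r"] r less.prems
        by (intro mult_right_mono mult_left_mono) (auto simp: algebra_simps)
      ultimately have "real p * b N \<ge> real N * b (N - 1) - fact r * real p * b (N - r)" by linarith
      then have "b N \<ge> ratio r N * b (N - 1) - fact r * b (N - r)"
        using p unfolding ra by (simp add: field_simps)
      then have *: "b N \<ge> y * ratio r N * b (N - 1)"
        using key by (simp add: y_def algebra_simps)
      moreover have "0 \<le> y * ratio r N * b (N - 1)"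
        using y ratio_nonneg nn[of "N - 1"] less.prems by simp
      ultimately show ?thesis by linarith
    qed
  qed
  show ?thesis
    using first[of N] b_r step[of N] by (cases N r rule: linorder_cases) auto
qed

section \<open>Linear identities between the coefficients, for an arbitrary constant
  \<open>c\<close>\<close>

locale grz =
  fixes r :: nat and c :: real and F :: "(nat \<Rightarrow> int) \<Rightarrow> real"
  assumes r2: "2 \<le> r"
    and neg: "\<And>m i. i < r \<Longrightarrow> m i < 0 \<Longrightarrow> F m = 0"
    and recur: "\<And>m. F m = (\<Sum>k<r. F (m - unit_vec k)) - c * F (m - ones r) + (if m = 0 then 1 else 0)"
begin

lemma weight_neg: "weight r m < 0 \<Longrightarrow> F m = 0"
  using neg weight_neg_imp by metis

lemma F_0: "F 0 = 1"
proof -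
  have "F (0 - unit_vec k) = 0" if "k < r" for k
    using that neg[of k "0 - unit_vec k"] by (simp add: unit_vec_def)
  moreover have "F (0 - ones r) = 0"
    using r2 neg[of 0 "0 - ones r"] by (simp add: ones_def)
  ultimately show ?thesis using recur[of 0] by simp
qed

text \<open>Leibniz rule for the Euler operator \<open>t_i d/dt_i\<close>, applied to
  \<open>D * t^v * Phi = t^v\<close>, where \<open>D = 1 - S + c P\<close> and
  \<open>Phi = 1 / D\<close>. The operator sends \<open>D\<close> to \<open>- t_i + c P\<close>,
  which gives the two shifted terms on the right.\<close>

lemma recur_linear:
  assumes i: "i < r"
  shows "of_int (m i) * F (m - v) - (\<Sum>l<r. of_int ((m - unit_vec l) i) * F (m - unit_vec l - v))
     + c * (of_int ((m - ones r) i) * F (m - ones r - v))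
   = F (m - unit_vec i - v) - c * F (m - ones r - v) + (if m = v then of_int (m i) else 0)"
proof -
  have "(\<Sum>l<r. of_int ((m - unit_vec l) i) * F (m - unit_vec l - v))
     = (\<Sum>l<r. of_int (m i) * F (m - v - unit_vec l) - (if l = i then F (m - unit_vec i - v) else 0))"
    by (intro sum.cong) (auto simp: unit_vec_def algebra_simps)
  also have "\<dots> = of_int (m i) * (\<Sum>l<r. F (m - v - unit_vec l)) - F (m - unit_vec i - v)"
    using i by (simp add: sum_subtractf sum_distrib_left)
  finally have *: "(\<Sum>l<r. of_int ((m - unit_vec l) i) * F (m - unit_vec l - v))
     = of_int (m i) * (\<Sum>l<r. F (m - v - unit_vec l)) - F (m - unit_vec i - v)" .
  have "(m - ones r) i = m i - 1" using i by (simp add: ones_def)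
  moreover have "m - v - ones r = m - ones r - v" by (simp add: algebra_simps)
  ultimately show ?thesis
    unfolding * by (subst recur[of "m - v"]) (auto simp: algebra_simps)
qed

text \<open>In terms of the generating function \<open>\<Phi> = 1 / (1 - S + c P)\<close>, this says that \<open>\<Phi>\<close> is killed
  by the derivation \<open>\<partial>\<^sub>i - \<partial>\<^sub>k - c P / (t\<^sub>i t\<^sub>k) (t\<^sub>i \<partial>\<^sub>i - t\<^sub>k \<partial>\<^sub>k)\<close>, which
  kills the denominator.\<close>

lemma exchange:
  assumes i: "i < r" and k: "k < r"
  shows "of_int (m i) * F (m - unit_vec k) - of_int (m k) * F (m - unit_vec i)
     = c * of_int (m i - m k) * F (m - ones r)"
proof (cases "i = k")
  case False
  \<comment> \<open>\<open>T\<close> is the defect of the claimed identity. It satisfies the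
    recurrence of \<open>F\<close> without a source term, so its vanishing on nonpositive weights
    propagates to all weights.\<close>
  define T where "T m = of_int (m i) * F (m - unit_vec k) - of_int (m k) * F (m - unit_vec i)
     - c * (of_int (m i) * F (m - ones r) - of_int (m k) * F (m - ones r))" for m
  have T_rec: "T m = (\<Sum>l<r. T (m - unit_vec l)) - c * T (m - ones r)" for m
  proof -
    \<comment> \<open>These remove the source terms of \<open>recur_linear\<close>: two are zero,
      and the two at \<open>ones r\<close> cancel each other.\<close>
    have "(m :: nat \<Rightarrow> int) = unit_vec k \<Longrightarrow> m i = 0" "m = unit_vec i \<Longrightarrow> m k = 0"
        "m = ones r \<Longrightarrow> m i = m k"
      using False i k by (auto simp: unit_vec_def ones_def)
    note * = recur_linear[OF i, of m "unit_vec k"] recur_linear[OF k, of m "unit_vec i"]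
       recur_linear[OF i, of m "ones r"] recur_linear[OF k, of m "ones r"]
    have sumT: "(\<Sum>l<r. T (m - unit_vec l)) =
        (\<Sum>l<r. of_int ((m - unit_vec l) i) * F (m - unit_vec l - unit_vec k))
      - (\<Sum>l<r. of_int ((m - unit_vec l) k) * F (m - unit_vec l - unit_vec i))
      - c * ((\<Sum>l<r. of_int ((m - unit_vec l) i) * F (m - unit_vec l - ones r))
           - (\<Sum>l<r. of_int ((m - unit_vec l) k) * F (m - unit_vec l - ones r)))"
      unfolding T_def by (simp only: sum_subtractf sum_distrib_left[symmetric])
    have cm: "m - unit_vec k - unit_vec i = m - unit_vec i - unit_vec k"
      "m - unit_vec i - ones r = m - ones r - unit_vec i"
      "m - unit_vec k - ones r = m - ones r - unit_vec k"
      by (simp_all add: algebra_simps)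
    define z where "z = (if m = ones r then of_int (m i) else (0::real))"
    have z: "(if m = unit_vec k then of_int (m i) else 0) = (0::real)"
      "(if m = unit_vec i then of_int (m k) else 0) = (0::real)"
      "(if m = ones r then of_int (m i) else (0::real)) = z"
      "(if m = ones r then of_int (m k) else (0::real)) = z"
      using \<open>m = unit_vec k \<Longrightarrow> m i = 0\<close> \<open>m = unit_vec i \<Longrightarrow> m k = 0\<close> \<open>m = ones r \<Longrightarrow> m i = m k\<close>
      by (auto simp: z_def)
    show ?thesis
      using * unfolding sumT z unfolding T_def cm by algebra
  qed
  have T0: "T m = 0" if "weight r m \<le> 0" for m
  proof -
    have "F (m - unit_vec k) = 0" "F (m - unit_vec i) = 0" "F (m - ones r) = 0"
      using that i k r2 by (auto intro!: weight_neg simp: weight_diff weight_unit_vec weight_ones)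
    then show ?thesis by (simp add: T_def)
  qed
  have "T m = 0" for m
  proof (induction "nat (weight r m)" arbitrary: m rule: less_induct)
    case less
    show ?case
    proof (cases "weight r m \<le> 0")
      case False
      have "T (m - unit_vec l) = 0" if "l < r" for l
        using False that by (intro less) (simp add: weight_diff weight_unit_vec)
      moreover have "T (m - ones r) = 0"
        using False r2 by (intro less) (simp add: weight_diff weight_ones)
      ultimately show ?thesis using T_rec[of m] by simp
    qed (rule T0)
  qed
  from this[of m] show ?thesis by (simp add: T_def algebra_simps)
qed auto

text \<open>Summing \<open>exchange\<close> over \<open>k\<close> produces \<open>m i\<close> times
  the full sum of the \<open>F (m - unit_vec k)\<close>, which \<open>recur\<close> trades for
  \<open>F m\<close> and \<open>F (m - ones r)\<close>.\<close>

lemma two_term_recurrence: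
  assumes i: "i < r" and "m \<noteq> 0"
  shows "of_int (m i) * F m = of_int (weight r m) * F (m - unit_vec i)
     - c * of_int (weight r m - (int r - 1) * m i) * F (m - ones r)"
proof -
  have "(\<Sum>k<r. of_int (m i) * F (m - unit_vec k))
     = (\<Sum>k<r. of_int (m k) * F (m - unit_vec i) + c * F (m - ones r) * (of_int (m i) - of_int (m k)))"
    using exchange[OF i] by (intro sum.cong) (auto simp: algebra_simps)
  also have "\<dots> = of_int (weight r m) * F (m - unit_vec i)
       + c * F (m - ones r) * (real r * of_int (m i) - of_int (weight r m))"
    by (simp add: sum.distrib sum_distrib_right[symmetric] sum_distrib_left[symmetric] sum_subtractf
        weight_def)
  finally have *: "of_int (m i) * (\<Sum>k<r. F (m - unit_vec k)) = of_int (weight r m) * F (m - unit_vec i)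
       + c * F (m - ones r) * (real r * of_int (m i) - of_int (weight r m))"
    by (simp add: sum_distrib_left)
  have "of_int (m i) * F m = of_int (m i) * (\<Sum>k<r. F (m - unit_vec k)) - of_int (m i) * c * F (m - ones r)"
    using \<open>m \<noteq> 0\<close> by (subst recur[of m]) (simp add: algebra_simps)
  then show ?thesis unfolding * by (simp add: algebra_simps)
qed

section \<open>Balanced vectors and the recurrence along their chain\<close>

definition balanced :: "nat \<Rightarrow> nat \<Rightarrow> int" where
  "balanced N = (\<lambda>i. if i < r then int (N div r) + (if i < N mod r then 1 else 0) else 0)"

lemma balanced_Suc: "balanced (Suc N) = balanced N + unit_vec (N mod r)"
proof
  fix i
  have "N mod r < r" using r2 by simp
  then show "balanced (Suc N) i = (balanced N + unit_vec (N mod r)) i"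
    using r2 by (auto simp: balanced_def unit_vec_def mod_Suc div_Suc)
qed

lemma balanced_0: "balanced 0 = 0"
  by (auto simp: balanced_def)

lemma balanced_add: "balanced (N + r) = balanced N + ones r"
  using r2 by (auto simp: balanced_def ones_def)

lemma weight_balanced: "weight r (balanced N) = int N"
proof (induction N)
  case 0
  then show ?case by (simp add: balanced_0 weight_def)
next
  case (Suc N)
  have "N mod r < r" using r2 by simp
  then show ?case using Suc unfolding balanced_Suc weight_add by (simp add: weight_unit_vec)
qed

text \<open>The direction \<open>N mod r\<close> is chosen because subtracting its unit vector from
  \<open>balanced (Suc N)\<close> gives \<open>balanced N\<close>. For \<open>Suc N >= r\<close>,
  subtracting \<open>ones r\<close> also gives a balanced vector, so the recurrence closes up.
  \<open>p\<close> is the entry raised last.\<close>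

lemma balanced_recurrence:
  fixes N
  defines "p \<equiv> real (N div r + 1)"
  shows "p * F (balanced (Suc N)) = real (Suc N) * F (balanced N)
     - c * (real (Suc N) - (real r - 1) * p) * F (balanced (Suc N) - ones r)"
proof -
  have i: "N mod r < r" using r2 by simp
  have v: "balanced (Suc N) (N mod r) = int (N div r + 1)"
    using i by (simp add: balanced_Suc unit_vec_def) (simp add: balanced_def)
  then have nz: "balanced (Suc N) \<noteq> 0"
    by (metis weight_balanced weight_def of_nat_eq_0_iff nat.distinct(1) sum.neutral zero_fun_def)
  show ?thesis
    using two_term_recurrence[OF i nz] unfolding v weight_balanced p_def
    by (simp add: balanced_Suc algebra_simps)
qed

lemma balanced_recurrence_small:
  assumes "Suc N < r"
  shows "F (balanced (Suc N)) = real (Suc N) * F (balanced N)"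
proof -
  have "F (balanced (Suc N) - ones r) = 0"
    using assms by (intro weight_neg) (simp add: weight_diff weight_balanced weight_ones)
  then show ?thesis using balanced_recurrence[of N] assms by simp
qed

text \<open>The outer induction is on the weight, the inner one on the l1 distance to the balanced
  vector of the same weight. Moving one unit from a too large entry to a too small one brings the
  vector closer, and \<open>exchange\<close> writes the old coefficient through the new one and one
  of smaller weight.\<close>

lemma nonneg_if_balanced_nonneg:
  assumes "c \<ge> 0" and bal: "\<And>N. F (balanced N) \<ge> 0"
    and supp: "\<And>m i. r \<le> i \<Longrightarrow> m i \<noteq> 0 \<Longrightarrow> F m = 0"
  shows "F n \<ge> 0"
proof (induction "nat (weight r n)" arbitrary: n rule: less_induct)
  case less
  note outer = less
  define N where "N = nat (weight r n)"
  show ?case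
  proof (cases "weight r n < 0 \<or> (\<exists>i\<ge>r. n i \<noteq> 0)")
    case True
    then show ?thesis using weight_neg supp by force
  next
    case False
    then have outer_nonneg: "0 \<le> weight r n" by simp
    have "weight r n = int N" "\<forall>i\<ge>r. n i = 0" using False by (auto simp: N_def)
    then show ?thesis
    proof (induction "nat (\<Sum>i<r. \<bar>n i - balanced N i\<bar>)" arbitrary: n rule: less_induct)
      case (less n)
      define B where "B = balanced N"
      have tot: "(\<Sum>i<r. n i) = (\<Sum>i<r. B i)"
        using less.prems weight_balanced[of N] by (simp add: weight_def B_def)
      show ?case
      proof (cases "n = B")
        case True
        then show ?thesis using bal by (simp add: B_def)
      next
        case False
        then obtain j where "n j \<noteq> B j" by auto
        then have j: "j < r"
          using less.prems(2) unfolding B_def balanced_def by (metis (full_types) not_le)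
        \<comment> \<open>Vectors with equal totals that differ must differ in both
          directions.\<close>
        have "\<exists>i<r. n i > B i"
        proof (rule ccontr)
          assume no: "\<not> ?thesis"
          then have le: "n l \<le> B l" if "l < r" for l using that no by (meson not_le)
          then have "n j < B j" using j \<open>n j \<noteq> B j\<close> by (simp add: order.not_eq_order_implies_strict)
          then have "(\<Sum>i<r. n i) < (\<Sum>i<r. B i)"
            using j le by (intro sum_strict_mono_ex1) auto
          then show False using tot by simp
        qed
        then obtain i where i: "i < r" "n i > B i" by blast
        have "\<exists>k<r. n k < B k"
        proof (rule ccontr)
          assume no: "\<not> ?thesis"
          then have le: "B l \<le> n l" if "l < r" for l using that no by (meson not_le)
          then have "B j < n j" using j \<open>n j \<noteq> B j\<close> by (simp add: order.not_eq_order_implies_strict)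
          then have "(\<Sum>i<r. B i) < (\<Sum>i<r. n i)"
            using j le by (intro sum_strict_mono_ex1) auto
          then show False using tot by simp
        qed
        then obtain k where k: "k < r" "n k < B k" by blast
        \<comment> \<open>Entries of \<open>B\<close> at indices below \<open>r\<close> differ by at
          most 1 and are nonnegative, so \<open>n i >= B i + 1 >= B k >= n k + 1\<close>.\<close>
        have ik: "n k + 1 \<le> n i" "n i > 0"
          using i k by (auto simp: B_def balanced_def split: if_splits)
        define n' where "n' = n + unit_vec k - unit_vec i"
        have "i \<noteq> k" using i k by auto
        have "(\<Sum>l<r. \<bar>n' l - B l\<bar>) < (\<Sum>l<r. \<bar>n l - B l\<bar>)"
          using i k \<open>i \<noteq> k\<close>
          by (intro sum_strict_mono_ex1) (auto simp: n'_def unit_vec_def intro!: bexI[of _ i])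
        moreover have "(\<Sum>l<r. \<bar>n' l - B l\<bar>) \<ge> 0" by (simp add: sum_nonneg)
        ultimately have "nat (\<Sum>l<r. \<bar>n' l - B l\<bar>) < nat (\<Sum>l<r. \<bar>n l - B l\<bar>)" by linarith
        moreover have "weight r n' = int N"
          using i k less.prems unfolding n'_def weight_diff weight_add by (simp add: weight_unit_vec)
        moreover have "\<forall>l\<ge>r. n' l = 0"
          using i k less.prems by (simp add: n'_def unit_vec_def)
        ultimately have "F n' \<ge> 0"
          unfolding B_def by (rule less.hyps)
        show ?thesis
        proof (cases "n k < 0")
          case True
          then show ?thesis using neg k by simp
        next
          case False
          \<comment> \<open>\<open>exchange\<close> is used at \<open>n + unit_vec k\<close>. By
            \<open>ik\<close> and the nonnegativity of \<open>n k\<close>, both coefficients on the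
            right are nonnegative.\<close>
          have "of_int (n i) * F n = of_int (n k + 1) * F n' + c * of_int (n i - (n k + 1)) * F (n + unit_vec k - ones r)"
            using exchange[OF i(1) k(1), of "n + unit_vec k"] \<open>i \<noteq> k\<close>
            by (simp add: n'_def unit_vec_def)
          moreover have "F (n + unit_vec k - ones r) \<ge> 0"
          proof (cases "weight r (n + unit_vec k - ones r) < 0")
            case True
            then show ?thesis by (simp add: weight_neg)
          next
            case nn: False
            then show ?thesis
              using k r2 less.prems outer_nonneg unfolding N_def
              by (intro outer) (simp add: weight_diff weight_add weight_unit_vec weight_ones)
          qed
          ultimately have "of_int (n i) * F n \<ge> 0"
            using \<open>F n' \<ge> 0\<close> \<open>c \<ge> 0\<close> ik False by simp
          then show ?thesis using ik by (simp add: zero_le_mult_iff)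
        qed
      qed
    qed
  qed
qed

end

section \<open>Transfer from power series to functions on integer vectors\<close>

definition extend :: "nat \<Rightarrow> ((nat \<Rightarrow> nat) \<Rightarrow> real) \<Rightarrow> (nat \<Rightarrow> int) \<Rightarrow> real" where
  "extend r F z = (if (\<forall>i. 0 \<le> z i) \<and> (\<forall>i\<ge>r. z i = 0) then F (nat \<circ> z) else 0)"

lemma extend_eq_0:
  assumes "z i < 0 \<or> (r \<le> i \<and> z i \<noteq> 0)"
  shows "extend r F z = 0"
  using assms unfolding extend_def by (metis not_le)

lemma extend_int: "m \<in> mi_supp r \<Longrightarrow> extend r F (int \<circ> m) = F m"
  by (simp add: extend_def mi_supp_def comp_def)

lemma finite_below: "finite {a \<in> mi_supp r. \<forall>i. a i \<le> m i}"
proof (rule finite_subset)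
  show "{a \<in> mi_supp r. \<forall>i. a i \<le> m i}
      \<subseteq> {f. \<forall>x. (x \<in> {..<r} \<longrightarrow> f x \<in> {..\<Sum>i<r. m i}) \<and> (x \<notin> {..<r} \<longrightarrow> f x = 0)}"
    by (auto simp: mi_supp_def intro: order_trans[OF _ member_le_sum])
  show "finite {f. \<forall>x. (x \<in> {..<r} \<longrightarrow> f x \<in> {..\<Sum>i<r. m i}) \<and> (x \<notin> {..<r} \<longrightarrow> f x = (0::nat))}"
    by (rule finite_set_of_finite_funs) auto
qed

text \<open>The denominator is a combination of monomials, and convolution with a monomial is a
  shift. \<open>extend\<close> supplies the value 0 exactly when the monomial's exponent is not
  below \<open>m\<close>.\<close>

lemma mfps_mult_denom:
  assumes m: "m \<in> mi_supp r"
  shows "mfps_mult r (denom r) F m = extend r F (int \<circ> m)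
     - (\<Sum>k<r. extend r F ((int \<circ> m) - unit_vec k)) + fact r * extend r F ((int \<circ> m) - ones r)"
proof -
  define A where "A = {a \<in> mi_supp r. \<forall>i. a i \<le> m i}"
  have monomial: "(\<Sum>a\<in>A. (if a = v then 1 else 0) * F (\<lambda>i. m i - a i)) = extend r F ((int \<circ> m) - (int \<circ> v))"
    if v: "v \<in> mi_supp r" for v
  proof -
    have "(\<Sum>a\<in>A. (if a = v then 1 else 0) * F (\<lambda>i. m i - a i))
        = (\<Sum>a\<in>A. if a = v then F (\<lambda>i. m i - v i) else 0)"
      by (intro sum.cong) auto
    also have "\<dots> = (if v \<in> A then F (\<lambda>i. m i - v i) else 0)"
      using finite_below by (simp add: A_def)
    also have "\<dots> = extend r F ((int \<circ> m) - (int \<circ> v))"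
      using m v by (auto simp: extend_def A_def mi_supp_def comp_def nat_diff_distrib)
    finally show ?thesis .
  qed
  define U O' where "U k = (\<lambda>j. if j = k then 1 else (0::nat))"
    and "O' = (\<lambda>j. if j < r then 1 else (0::nat))" for k :: nat
  have "mfps_mult r (denom r) F m =
      (\<Sum>a\<in>A. (if a = (\<lambda>_. 0) then 1 else 0) * F (\<lambda>i. m i - a i)
        - (\<Sum>k<r. (if a = U k then 1 else 0) * F (\<lambda>i. m i - a i))
        + fact r * ((if a = O' then 1 else 0) * F (\<lambda>i. m i - a i)))"
    unfolding mfps_mult_def denom_def A_def U_def O'_def
    by (intro sum.cong refl) (simp only: ring_distribs sum_distrib_right mult.assoc)
  also have "\<dots> = (\<Sum>a\<in>A. (if a = (\<lambda>_. 0) then 1 else 0) * F (\<lambda>i. m i - a i))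
        - (\<Sum>k<r. \<Sum>a\<in>A. (if a = U k then 1 else 0) * F (\<lambda>i. m i - a i))
        + fact r * (\<Sum>a\<in>A. (if a = O' then 1 else 0) * F (\<lambda>i. m i - a i))"
    by (subst sum.swap[of _ A "{..<r}"]) (simp only: sum.distrib sum_subtractf sum_distrib_left)
  also have "\<dots> = extend r F ((int \<circ> m) - (int \<circ> (\<lambda>_. 0)))
     - (\<Sum>k<r. extend r F ((int \<circ> m) - (int \<circ> U k))) + fact r * extend r F ((int \<circ> m) - (int \<circ> O'))"
    by (intro arg_cong2[where f = "(+)"] arg_cong2[where f = "(-)"] arg_cong2[where f = "(*)"]
        sum.cong refl monomial) (auto simp: mi_supp_def U_def O'_def)
  also have "(int \<circ> m) - (int \<circ> (\<lambda>_. 0)) = int \<circ> m" by auto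
  also have "int \<circ> O' = ones r" by (auto simp: O'_def ones_def)
  also have "(\<Sum>k<r. extend r F ((int \<circ> m) - (int \<circ> U k))) = (\<Sum>k<r. extend r F ((int \<circ> m) - unit_vec k))"
    by (intro sum.cong refl arg_cong[of _ _ "extend r F"]) (auto simp: U_def unit_vec_def)
  finally show ?thesis .
qed

lemma inverse_imp_grz:
  assumes r: "2 \<le> r" and F: "\<forall>m\<in>mi_supp r. mfps_mult r (denom r) F m = mfps_one m"
  shows "grz r (fact r) (extend r F)"
proof
  show "2 \<le> r" by fact
  show "extend r F m = 0" if "m i < 0" for m i
    using that by (intro extend_eq_0[of _ i]) auto
  show "extend r F z = (\<Sum>k<r. extend r F (z - unit_vec k)) - fact r * extend r F (z - ones r)
      + (if z = 0 then 1 else 0)" for z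
  proof (cases "(\<forall>i. 0 \<le> z i) \<and> (\<forall>i\<ge>r. z i = 0)")
    case True
    define m where "m = nat \<circ> z"
    have z: "z = int \<circ> m" "m \<in> mi_supp r" using True by (auto simp: m_def mi_supp_def)
    have "mfps_one m = (if z = 0 then 1 else 0)"
      by (auto simp: z(1) mfps_one_def fun_eq_iff)
    then show ?thesis using F mfps_mult_denom[OF z(2), of F] z by auto
  next
    case False
    then obtain i where i: "z i < 0 \<or> (r \<le> i \<and> z i \<noteq> 0)" by (auto simp: not_le)
    \<comment> \<open>Outside the support both sides vanish: the shifts keep a negative entry
      negative and do not touch entries at indices from \<open>r\<close> on.\<close>
    then have "extend r F (z - unit_vec k) = 0" if "k < r" for k
      using that by (intro extend_eq_0[of _ i]) (auto simp: unit_vec_def)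
    moreover have "extend r F (z - ones r) = 0"
      using i by (intro extend_eq_0[of _ i]) (auto simp: ones_def)
    moreover have "z \<noteq> 0" using i by auto
    moreover have "extend r F z = 0" using i by (rule extend_eq_0)
    ultimately show ?thesis by simp
  qed
qed

section \<open>Existence of the inverse series by iterating the recurrence\<close>

primrec approx :: "nat \<Rightarrow> nat \<Rightarrow> (nat \<Rightarrow> int) \<Rightarrow> real" where
  "approx r 0 = (\<lambda>m. if m = 0 then 1 else 0)"
| "approx r (Suc n) = (\<lambda>m. (\<Sum>k<r. approx r n (m - unit_vec k)) - fact r * approx r n (m - ones r)
      + (if m = 0 then 1 else 0))"

lemma approx_eq_0:
  assumes "m i < 0 \<or> (r \<le> i \<and> m i \<noteq> 0)"
  shows "approx r n m = 0"
  using assms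
proof (induction n arbitrary: m)
  case (Suc n)
  have "approx r n (m - unit_vec k) = 0" if "k < r" for k
    using Suc.prems that by (intro Suc.IH) (auto simp: unit_vec_def)
  moreover have "approx r n (m - ones r) = 0"
    using Suc.prems by (intro Suc.IH) (auto simp: ones_def)
  moreover have "m \<noteq> 0" using Suc.prems by auto
  ultimately show ?case by simp
qed auto

text \<open>Each unfolding lowers the weight by 1 or by \<open>r\<close>, so the iterates have
  stabilised at weight \<open>n\<close> after \<open>n\<close> rounds.\<close>

lemma approx_Suc_eq:
  assumes "0 < r" "weight r m \<le> int n"
  shows "approx r (Suc n) m = approx r n m"
  using assms(2)
proof (induction n arbitrary: m)
  case 0
  have "m - unit_vec k \<noteq> 0" if "k < r" for k
    using that 0 weight_unit_vec[of k r] by auto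
  moreover have "m - ones r \<noteq> 0"
    using 0 assms(1) weight_ones[of r] by auto
  ultimately show ?case by simp
next
  case (Suc n)
  have "approx r (Suc n) (m - unit_vec k) = approx r n (m - unit_vec k)" if "k < r" for k
  proof (rule Suc.IH)
    show "weight r (m - unit_vec k) \<le> int n"
      using that Suc.prems by (simp add: weight_diff weight_unit_vec)
  qed
  moreover have "approx r (Suc n) (m - ones r) = approx r n (m - ones r)"
  proof (rule Suc.IH)
    show "weight r (m - ones r) \<le> int n"
      using assms(1) Suc.prems by (simp add: weight_diff weight_ones)
  qed
  ultimately show ?case
    by (subst (1 2) approx.simps) (simp del: approx.simps)
qed

lemma inverse_exists:
  assumes "0 < r"
  shows "\<exists>F. \<forall>m\<in>mi_supp r. mfps_mult r (denom r) F m = mfps_one m"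
proof -
  define G where "G m = approx r (nat (weight r m)) m" for m
  have G: "approx r n m = G m" if "weight r m \<le> int n" for n m
  proof -
    have "nat (weight r m) \<le> n" using that by simp
    then show ?thesis
    proof (induction n rule: dec_induct)
      case (step n)
      then show ?case using approx_Suc_eq[OF assms, of m n] by simp
    qed (simp add: G_def)
  qed
  have G_rec: "G m = (\<Sum>k<r. G (m - unit_vec k)) - fact r * G (m - ones r) + (if m = 0 then 1 else 0)" for m
  proof -
    let ?n = "nat (weight r m)"
    have "approx r ?n (m - unit_vec k) = G (m - unit_vec k)" if "k < r" for k
      using that by (intro G) (simp add: weight_diff weight_unit_vec)
    moreover have "approx r ?n (m - ones r) = G (m - ones r)"
      by (intro G) (simp add: weight_diff weight_ones)
    \<comment> \<open>One iterate beyond the one defining \<open>G m\<close>, so that unfolding it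
      leaves iterate \<open>?n\<close> at the shifted vectors.\<close>
    moreover have "G m = approx r (Suc ?n) m"
      by (rule G[symmetric]) simp
    ultimately show ?thesis by simp
  qed
  have ext: "extend r (\<lambda>m. G (int \<circ> m)) z = G z" for z
  proof (cases "(\<forall>i. 0 \<le> z i) \<and> (\<forall>i\<ge>r. z i = 0)")
    case True
    then have "int \<circ> (nat \<circ> z) = z" by auto
    then show ?thesis using True by (simp add: extend_def)
  next
    case False
    then obtain i where "z i < 0 \<or> (r \<le> i \<and> z i \<noteq> 0)" by (auto simp: not_le)
    then show ?thesis unfolding G_def by (simp add: extend_eq_0 approx_eq_0)
  qed
  have "mfps_mult r (denom r) (\<lambda>m. G (int \<circ> m)) m = mfps_one m" if "m \<in> mi_supp r" for m
  proof -
    have "int \<circ> m = 0 \<longleftrightarrow> m = (\<lambda>_. 0)" by (auto simp: fun_eq_iff)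
    then show ?thesis
      unfolding mfps_mult_denom[OF that] ext mfps_one_def using G_rec[of "int \<circ> m"] by simp
  qed
  then show ?thesis by blast
qed

theorem theorem1:
  fixes r :: nat
  assumes "r \<ge> 8"
  shows "(\<exists>F. \<forall>m\<in>mi_supp r. mfps_mult r (denom r) F m = mfps_one m) \<and>
         (\<forall>F. (\<forall>m\<in>mi_supp r. mfps_mult r (denom r) F m = mfps_one m)
              \<longrightarrow> (\<forall>m\<in>mi_supp r. F m \<ge> 0))"
proof (intro conjI allI impI ballI)
  show "\<exists>F. \<forall>m\<in>mi_supp r. mfps_mult r (denom r) F m = mfps_one m"
    using assms by (intro inverse_exists) auto
next
  fix F m
  assume F: "\<forall>m\<in>mi_supp r. mfps_mult r (denom r) F m = mfps_one m" and m: "m \<in> mi_supp r"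
  interpret grz r "fact r" "extend r F"
    using assms F by (intro inverse_imp_grz) auto
  have "extend r F (balanced N) \<ge> 0" for N
  proof (rule balanced_sequence_nonneg[OF assms])
    show "extend r F (balanced 0) = 1" by (simp add: balanced_0 F_0)
    show "extend r F (balanced (Suc N)) = real (Suc N) * extend r F (balanced N)" if "Suc N < r" for N
      using that by (rule balanced_recurrence_small)
    show "real (N div r + 1) * extend r F (balanced (Suc N)) = real (Suc N) * extend r F (balanced N)
      - fact r * (real (Suc N) - (real r - 1) * real (N div r + 1)) * extend r F (balanced (Suc N - r))"
      if "r \<le> Suc N" for N
      using balanced_recurrence[of N] balanced_add[of "Suc N - r"] that by simp
  qed
  moreover have "extend r F z = 0" if "r \<le> i" "z i \<noteq> 0" for z i
    using that by (intro extend_eq_0[of _ i]) simp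
  ultimately have "extend r F (int \<circ> m) \<ge> 0"
    using nonneg_if_balanced_nonneg fact_ge_zero by blast
  then show "F m \<ge> 0" using m by (simp add: extend_int)
qed

end
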